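(* The group $(\mathcal{A},\bullet)$ is the internal direct sum $\mathcal{A}=U\oplus C$, and $U=V\oplus W$, where $U:=\{f\in\mathcal{A}: f(0)=1\}$, $C:=\{ce: c\in\mathbb{C},\ c\neq0\}$, $V:=\{f\in\mathcal{A}: f(k_1+k_2)=f(k_1)f(k_2)\text{ for all }k_1,k_2\in\mathbb{N}_0\}$, and $W:=\{f\in\mathcal{A}: f(0)=1,\ f(1)=0\}$.
   Context: An arithmetic function is a map $\mathbb{N}_0\to\mathbb{C}$, $\mathbb{N}_0$ the nonnegative integers. The Cauchy-type product is $(f\bullet g)(k):=\sum_{m=0}^{k}\binom{k}{m}f(m)g(k-m)$. $\mathcal{A}$ is the set of arithmetic functions $f$ with $f(0)\neq0$, an abelian group under $\bullet$ with identity $e$, where $e(0)=1$, $e(k)=0$ for $k>0$; $ce$ denotes $k\mapsto c\,e(k)$. $U,C,V,W$ are subgroups of $(\mathcal{A},\bullet)$. *)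

theory Defs
  imports Complex_Main "HOL-Algebra.Algebra"
begin

type_synonym arith_fun = "nat \<Rightarrow> complex"

definition cauchy_prod :: "arith_fun \<Rightarrow> arith_fun \<Rightarrow> arith_fun" where
  "cauchy_prod f g = (\<lambda>k. \<Sum>m=0..k. of_nat (k choose m) * f m * g (k - m))"

definition arith_unit :: arith_fun where
  "arith_unit = (\<lambda>k. if k = 0 then 1 else 0)"

definition arith_group :: "arith_fun monoid" where
  "arith_group = \<lparr>carrier = {f. f 0 \<noteq> 0}, monoid.mult = cauchy_prod, one = arith_unit\<rparr>"

definition group_U :: "arith_fun set" where
  "group_U = {f \<in> carrier arith_group. f 0 = 1}"

definition group_C :: "arith_fun set" where
  "group_C = {\<lambda>k. c * arith_unit k | c. c \<noteq> 0}"

definition group_V :: "arith_fun set" where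
  "group_V = {f \<in> carrier arith_group. \<forall>k1 k2. f (k1 + k2) = f k1 * f k2}"

definition group_W :: "arith_fun set" where
  "group_W = {f \<in> carrier arith_group. f 0 = 1 \<and> f 1 = 0}"

(* The library has no predicate for internal direct sums. The group laws of G are part of
   the definition; normality of H and K needs no mention because G is abelian. *)
definition internal_direct_sum :: "('a, 'b) monoid_scheme \<Rightarrow> 'a set \<Rightarrow> 'a set \<Rightarrow> bool" where
  "internal_direct_sum G H K \<longleftrightarrow>
     comm_group G \<and> subgroup H G \<and> subgroup K G \<and>
     H \<inter> K = {\<one>\<^bsub>G\<^esub>} \<and> H <#>\<^bsub>G\<^esub> K = carrier G"

end

theory Submission
  imports Defs "HOL-Computational_Algebra.Formal_Power_Series"
begin

text \<open>
  Passing to exponential generating functions turns the Cauchy-type product into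
  multiplication of formal power series, so the group laws are inherited from units of the power
  series ring.  The elements of \<^const>\<open>group_V\<close> are the sequences \<open>a ^ k\<close>, whose generating
  functions are \<open>exp (a X)\<close>; dividing \<open>f\<close> with \<open>f 0 = 1\<close> by the element with \<open>a = f 1\<close>
  kills the value at \<open>1\<close>.
\<close>

definition egf :: "arith_fun \<Rightarrow> complex fps" where
  "egf f = Abs_fps (\<lambda>k. f k / fact k)"

lemma egf_nth [simp]: "fps_nth (egf f) k = f k / fact k"
  by (simp add: egf_def)

text \<open>Used from right to left below: an identity of arithmetic functions becomes one in the
  ring of power series, where commutativity and associativity come for free.\<close>

lemma egf_eq_iff: "egf f = egf g \<longleftrightarrow> f = g"
  by (auto simp: fps_eq_iff fun_eq_iff)

lemma egf_surj: "\<exists>f. egf f = F"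
  by (rule exI[of _ "\<lambda>k. fact k * fps_nth F k"]) (simp add: fps_eq_iff)

text \<open>Since \<open>n choose m\<close> is \<open>fact n / (fact m * fact (n - m))\<close>,
  dividing by \<open>fact n\<close> leaves one factorial under each factor.\<close>

lemma egf_cauchy_prod: "egf (cauchy_prod f g) = egf f * egf g"
proof (rule fps_ext)
  fix n
  have "of_nat (n choose m) * f m * g (n - m) / fact n = f m / fact m * (g (n - m) / fact (n - m))"
    if "m \<in> {0..n}" for m
    using that by (simp add: binomial_fact)
  then show "fps_nth (egf (cauchy_prod f g)) n = fps_nth (egf f * egf g) n"
    unfolding egf_nth fps_mult_nth cauchy_prod_def sum_divide_distrib by (rule sum.cong[OF refl])
qed

lemma egf_arith_unit: "egf arith_unit = 1"
  by (simp add: fps_eq_iff arith_unit_def)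

lemma egf_power: "egf (\<lambda>k. a ^ k) = fps_exp a"
  by (simp add: fps_eq_iff)

lemma cauchy_prod_0: "cauchy_prod f g 0 = f 0 * g 0"
  by (simp add: cauchy_prod_def)

lemma cauchy_prod_1: "cauchy_prod f g (Suc 0) = f 0 * g (Suc 0) + f (Suc 0) * g 0"
  by (simp add: cauchy_prod_def)

lemma cauchy_prod_commute: "cauchy_prod f g = cauchy_prod g f"
  by (simp add: egf_eq_iff[symmetric] egf_cauchy_prod mult.commute)

text \<open>The binomial theorem, read as the addition law of \<open>fps_exp\<close>. It makes the
  powers of \<open>a\<close> a homomorphic image of the additive group of complex numbers.\<close>

lemma cauchy_prod_power: "cauchy_prod (\<lambda>k. a ^ k) (\<lambda>k. b ^ k) = (\<lambda>k. (a + b) ^ k)"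
  by (simp only: egf_eq_iff[symmetric] egf_cauchy_prod egf_power fps_exp_add_mult)

lemma cauchy_prod_scaled_unit: "cauchy_prod (\<lambda>k. c * arith_unit k) f = (\<lambda>k. c * f k)"
proof -
  have "egf (\<lambda>k. c * arith_unit k) = fps_const c"
    by (simp add: fps_eq_iff arith_unit_def)
  then show ?thesis
    by (simp only: egf_eq_iff[symmetric] egf_cauchy_prod) (rule fps_ext, simp)
qed

lemma arith_group_simps [simp]:
  "carrier arith_group = {f. f 0 \<noteq> 0}"
  "f \<otimes>\<^bsub>arith_group\<^esub> g = cauchy_prod f g"
  "\<one>\<^bsub>arith_group\<^esub> = arith_unit"
  by (simp_all add: arith_group_def)

lemma arith_unit_simps [simp]: "arith_unit 0 = 1" "arith_unit (Suc k) = 0"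
  by (simp_all add: arith_unit_def)

lemma comm_group_arith_group: "comm_group arith_group"
proof (rule comm_groupI)
  fix f assume "f \<in> carrier arith_group"
  then have unit: "fps_nth (egf f) 0 \<noteq> 0"
    by simp
  \<comment> \<open>A series over a field with nonzero constant term is invertible; surjectivity of
    \<open>egf\<close> turns its inverse into an arithmetic function.\<close>
  obtain g where g: "egf g = inverse (egf f)"
    using egf_surj by blast
  have "egf (cauchy_prod g f) = egf arith_unit"
    using unit by (simp add: egf_cauchy_prod g egf_arith_unit inverse_mult_eq_1)
  then have gf: "cauchy_prod g f = arith_unit"
    by (simp only: egf_eq_iff)
  \<comment> \<open>Evaluating at 0 yields \<open>g 0 \<noteq> 0\<close>, so \<open>g\<close> lies
    in the carrier.\<close>
  then have "g 0 * f 0 = 1"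
    by (metis arith_unit_simps(1) cauchy_prod_0)
  then show "\<exists>g\<in>carrier arith_group. g \<otimes>\<^bsub>arith_group\<^esub> f = \<one>\<^bsub>arith_group\<^esub>"
    using gf by (intro bexI[of _ g]) auto
qed (auto simp: cauchy_prod_0 egf_eq_iff[symmetric] egf_cauchy_prod egf_arith_unit mult_ac)

interpretation arith: comm_group arith_group
  by (rule comm_group_arith_group)

text \<open>Compares \<open>f\<close> times its inverse with the unit at 0 and 1. These two values
  decide membership in \<open>group_U\<close> and \<open>group_W\<close>, so no formula for the
  whole inverse is needed.\<close>

lemma arith_inv_0_1:
  assumes "f 0 \<noteq> 0"
  shows "f 0 * (inv\<^bsub>arith_group\<^esub> f) 0 = 1"
    and "f 0 * (inv\<^bsub>arith_group\<^esub> f) (Suc 0) + f (Suc 0) * (inv\<^bsub>arith_group\<^esub> f) 0 = 0"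
proof -
  have "cauchy_prod f (inv\<^bsub>arith_group\<^esub> f) = arith_unit"
    using arith.r_inv[of f] assms by simp
  from fun_cong[OF this, of 0] fun_cong[OF this, of "Suc 0"]
  show "f 0 * (inv\<^bsub>arith_group\<^esub> f) 0 = 1"
    and "f 0 * (inv\<^bsub>arith_group\<^esub> f) (Suc 0) + f (Suc 0) * (inv\<^bsub>arith_group\<^esub> f) 0 = 0"
    by (simp_all add: cauchy_prod_0 cauchy_prod_1)
qed

lemma subgroup_U: "subgroup group_U arith_group"
proof (rule arith.subgroupI)
  show "group_U \<noteq> {}"
    by (auto simp: group_U_def intro: exI[of _ arith_unit])
next
  fix f assume "f \<in> group_U"
  then show "inv\<^bsub>arith_group\<^esub> f \<in> group_U"
    using arith_inv_0_1(1)[of f] by (simp add: group_U_def)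
qed (auto simp: group_U_def cauchy_prod_0)

lemma subgroup_W: "subgroup group_W arith_group"
proof (rule arith.subgroupI)
  show "group_W \<noteq> {}"
    by (auto simp: group_W_def intro: exI[of _ arith_unit])
next
  fix f assume "f \<in> group_W"
  then show "inv\<^bsub>arith_group\<^esub> f \<in> group_W"
    using arith_inv_0_1[of f] by (simp add: group_W_def)
qed (auto simp: group_W_def cauchy_prod_0 cauchy_prod_1)

lemma subgroup_C: "subgroup group_C arith_group"
proof (rule arith.subgroupI)
  fix f assume "f \<in> group_C"
  then obtain c where c: "c \<noteq> 0" and f: "f = (\<lambda>k. c * arith_unit k)"
    by (auto simp: group_C_def)
  have "inv\<^bsub>arith_group\<^esub> f = (\<lambda>k. inverse c * arith_unit k)"
    by (rule arith.inv_equality) (use c in \<open>auto simp: f cauchy_prod_scaled_unit\<close>)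
  then show "inv\<^bsub>arith_group\<^esub> f \<in> group_C"
    using c by (auto simp: group_C_def)
next
  fix f g assume "f \<in> group_C" "g \<in> group_C"
  then obtain c d where "c \<noteq> 0" "d \<noteq> 0" "f = (\<lambda>k. c * arith_unit k)" "g = (\<lambda>k. d * arith_unit k)"
    by (auto simp: group_C_def)
  then show "f \<otimes>\<^bsub>arith_group\<^esub> g \<in> group_C"
    by (auto simp: group_C_def cauchy_prod_scaled_unit mult.assoc[symmetric]
        intro!: exI[of _ "c * d"])
qed (auto simp: group_C_def intro: exI[of _ 1])

lemma group_V_eq_powers: "group_V = range (\<lambda>a k. a ^ k)"
proof (intro equalityI subsetI)
  fix f assume "f \<in> group_V"
  then have nz: "f 0 \<noteq> 0" and add: "f (k + l) = f k * f l" for k l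
    by (auto simp: group_V_def)
  \<comment> \<open>Taking both arguments 0 makes \<open>f 0\<close> idempotent, and it is
    nonzero.\<close>
  have "f 0 = 1"
    using nz add[of 0 0] by simp
  have "f k = f 1 ^ k" for k
  proof (induction k)
    case (Suc k)
    then show ?case
      using add[of 1 k] by (simp only: plus_1_eq_Suc power_Suc)
  qed (simp only: \<open>f 0 = 1\<close> power_0)
  then show "f \<in> range (\<lambda>a k. a ^ k)"
    by blast
qed (auto simp: group_V_def power_add)

lemma subgroup_V: "subgroup group_V arith_group"
proof (rule arith.subgroupI)
  fix f assume "f \<in> group_V"
  then obtain a where f: "f = (\<lambda>k. a ^ k)"
    by (auto simp: group_V_eq_powers)
  \<comment> \<open>The product is \<open>0 ^ k\<close>, which is the unit because
    \<open>0 ^ 0 = 1\<close>.\<close>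
  have "inv\<^bsub>arith_group\<^esub> f = (\<lambda>k. (- a) ^ k)"
    by (rule arith.inv_equality)
      (auto simp: f cauchy_prod_power arith_unit_def fun_eq_iff power_0_left)
  then show "inv\<^bsub>arith_group\<^esub> f \<in> group_V"
    by (auto simp: group_V_eq_powers)
qed (auto simp: group_V_eq_powers cauchy_prod_power)

theorem theorem18:
  shows "internal_direct_sum arith_group group_U group_C \<and>
         internal_direct_sum (arith_group\<lparr>carrier := group_U\<rparr>) group_V group_W"
proof
  have "group_U \<inter> group_C = {\<one>\<^bsub>arith_group\<^esub>}"
    by (auto simp: group_U_def group_C_def intro: exI[of _ 1])
  moreover have "f \<in> group_U <#>\<^bsub>arith_group\<^esub> group_C" if "f 0 \<noteq> 0" for f
  proof -
    \<comment> \<open>Normalise the value at 0 to 1; the scalar split off is the factor in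
      \<open>group_C\<close>.\<close>
    have "f = cauchy_prod (\<lambda>k. f k / f 0) (\<lambda>k. f 0 * arith_unit k)"
      using that by (simp add: cauchy_prod_commute[of "\<lambda>k. f k / f 0"] cauchy_prod_scaled_unit)
    moreover have "(\<lambda>k. f k / f 0) \<in> group_U" "(\<lambda>k. f 0 * arith_unit k) \<in> group_C"
      using that by (auto simp: group_U_def group_C_def)
    ultimately show ?thesis
      unfolding set_mult_def by auto
  qed
  moreover have "group_U <#>\<^bsub>arith_group\<^esub> group_C \<subseteq> carrier arith_group"
    by (intro arith.set_mult_closed subgroup.subset subgroup_U subgroup_C)
  ultimately show "internal_direct_sum arith_group group_U group_C"
    unfolding internal_direct_sum_def
    using comm_group_arith_group subgroup_U subgroup_C by auto
next
  let ?U = "arith_group\<lparr>carrier := group_U\<rparr>"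
  have VU: "group_V \<subseteq> group_U" and WU: "group_W \<subseteq> group_U"
    by (auto simp: group_V_eq_powers group_U_def group_W_def)
  interpret U: comm_group ?U
    by (intro group.group_comm_groupI subgroup.subgroup_is_group[OF subgroup_U arith.is_group])
      (simp add: cauchy_prod_commute)
  have sub: "subgroup group_V ?U" "subgroup group_W ?U"
    by (intro arith.subgroup_incl subgroup_U subgroup_V subgroup_W VU WU)+
  \<comment> \<open>The value of \<open>a ^ k\<close> at 1 is \<open>a\<close>, so membership in
    \<open>group_W\<close> forces \<open>a = 0\<close>, the exponent that gives the unit.\<close>
  have "group_V \<inter> group_W = {\<one>\<^bsub>?U\<^esub>}"
    by (auto simp: group_V_eq_powers group_W_def arith_unit_def fun_eq_iff power_0_left
        intro!: image_eqI[of _ _ 0])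
  moreover have "f \<in> group_V <#>\<^bsub>?U\<^esub> group_W" if "f \<in> group_U" for f
  proof -
    \<comment> \<open>\<open>?w\<close> is the quotient of \<open>f\<close> by \<open>?v\<close>.
      Its value at 1 is \<open>f 1 - f 1 * f 0\<close>, which vanishes as
      \<open>f 0 = 1\<close>.\<close>
    let ?v = "\<lambda>k. f 1 ^ k" and ?w = "cauchy_prod (\<lambda>k. (- f 1) ^ k) f"
    have "cauchy_prod ?v ?w = f"
      by (simp only: egf_eq_iff[symmetric] egf_cauchy_prod egf_power mult.assoc[symmetric]
          fps_exp_add_mult[symmetric]) simp
    moreover have "?v \<in> group_V" "?w \<in> group_W"
      using that
      by (auto simp: group_V_eq_powers group_W_def group_U_def cauchy_prod_0 cauchy_prod_1)
    ultimately show ?thesis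
      unfolding set_mult_def by force
  qed
  moreover have "group_V <#>\<^bsub>?U\<^esub> group_W \<subseteq> carrier ?U"
    by (intro U.set_mult_closed subgroup.subset sub)
  ultimately show "internal_direct_sum ?U group_V group_W"
    unfolding internal_direct_sum_def using U.comm_group_axioms sub by auto
qed

end
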